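(* Let $n\ge 2$, and let $P,Q$ be $n\times n$ matrices. Let $\alpha$ run over a basis of $so(n)$ and $\tilde\alpha$ over the corresponding dual basis. Then $$\sum_{\alpha}\mathrm{Tr}(P\alpha Q\tilde\alpha)=\tfrac12\bigl(\mathrm{Tr}(P)\mathrm{Tr}(Q)-\mathrm{Tr}(PQ^{*})\bigr)$$ and $$\sum_{\alpha}\mathrm{Tr}(P\alpha)\,\mathrm{Tr}(Q\tilde\alpha)=\tfrac12\bigl(\mathrm{Tr}(PQ)-\mathrm{Tr}(PQ^{*})\bigr).$$
   Context: Matrices are over a field of characteristic $0$. $so(n)$ is the Lie algebra of skew-symmetric $n\times n$ matrices, $Q^{*}$ denotes the transpose of $Q$, $\mathrm{Tr}$ is the ordinary matrix trace, and the dual basis is taken with respect to the form $\langle X,Y\rangle=\mathrm{Tr}(XY)$ on $so(n)$. *)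

theory Defs
  imports "HOL-Analysis.Analysis"
begin

text \<open>
  Over a general field, the library offers a scalar action only on vectors: \<open>(*s)\<close> at type
  \<open>'a^'n^'n\<close> would take its scalars from \<open>'a^'n\<close>, and \<open>(*\<^sub>R)\<close> is restricted to real scalars.
\<close>

definition matrix_scale :: "'a::times \<Rightarrow> 'a^'n^'m \<Rightarrow> 'a^'n^'m"
  where "matrix_scale c A = (\<chi> i j. c * A $ i $ j)"

interpretation matrix_vs:
  vector_space "matrix_scale :: 'a::field \<Rightarrow> 'a^'n^'m \<Rightarrow> 'a^'n^'m"
  by unfold_locales (simp_all add: matrix_scale_def vec_eq_iff algebra_simps)

definition so :: "('a::field^'n^'n) set"
  where "so = {A. transpose A = - A}"

definition is_basis_of :: "('a::field^'n^'m) set \<Rightarrow> ('a^'n^'m) set \<Rightarrow> bool"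
  where "is_basis_of B V \<longleftrightarrow> matrix_vs.independent B \<and> matrix_vs.span B = V"

text \<open>
  The dual basis is given as a map: \<open>d \<alpha>\<close> is the dual basis vector that corresponds to \<open>\<alpha> \<in> B\<close>.
  Values of \<open>d\<close> outside \<open>B\<close> are irrelevant.
\<close>

definition is_dual_basis_so ::
    "('a::field^'n^'n) set \<Rightarrow> ('a^'n^'n \<Rightarrow> 'a^'n^'n) \<Rightarrow> bool"
  where "is_dual_basis_so B d \<longleftrightarrow>
    d ` B \<subseteq> so \<and>
    (\<forall>\<alpha>\<in>B. \<forall>\<beta>\<in>B. trace (\<alpha> ** d \<beta>) = (if \<alpha> = \<beta> then 1 else 0))"

end

theory Submission
  imports Defs
begin

text \<open>
  Both sums are contractions of the tensor \<open>\<Sum>\<alpha>. \<alpha> \<otimes> dual \<alpha>\<close>, so it suffices to compute this tensor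
  once. Expanding a skew matrix in the basis gives \<open>X = (\<Sum>\<alpha>. Tr (X \<cdot> dual \<alpha>) \<alpha>)\<close>. A symmetric
  matrix is orthogonal to every skew one under the trace form, and therefore for an arbitrary matrix
  \<open>M\<close> the same sum is the skew part \<open>(M - M\<^sup>T) / 2\<close>; this is \<open>sum_trace_dual_eq_skew_part\<close>.

  The second identity follows by pairing this equation, for \<open>M = Q\<close>, with \<open>P\<close> under the trace. For
  the first, taking \<open>M\<close> to be a matrix unit gives the entries
  \<open>(\<Sum>\<alpha>. \<alpha>\<^sub>k\<^sub>l (dual \<alpha>)\<^sub>i\<^sub>j) = (\<delta>\<^sub>k\<^sub>j \<delta>\<^sub>l\<^sub>i - \<delta>\<^sub>k\<^sub>i \<delta>\<^sub>l\<^sub>j) / 2\<close> of the tensor, from which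
  \<open>(\<Sum>\<alpha>. \<alpha> Q dual \<alpha>) = (Tr Q \<cdot> 1 - Q\<^sup>T) / 2\<close>; multiply by \<open>P\<close> and take the trace.
\<close>

definition matrix_unit :: "'m \<Rightarrow> 'n \<Rightarrow> 'a::zero_neq_one^'n^'m"
  where "matrix_unit a b = (\<chi> i j. if i = a \<and> j = b then 1 else 0)"

lemma matrix_unit_nth: "matrix_unit a b $ i $ j = (if i = a \<and> j = b then 1 else 0)"
  by (simp add: matrix_unit_def)

lemma trace_matrix_unit_mult: "trace (matrix_unit a b ** A) = A $ b $ a"
  for A :: "'a::field^'n^'n"
proof -
  have "trace (matrix_unit a b ** A)
      = (\<Sum>i\<in>UNIV. \<Sum>k\<in>UNIV. if k = b then if i = a then A $ k $ i else 0 else 0)"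
    unfolding trace_def matrix_matrix_mult_def
    by (simp only: vec_lambda_beta, intro sum.cong refl) (simp add: matrix_unit_nth)
  also have "\<dots> = A $ b $ a"
    by simp
  finally show ?thesis .
qed

lemma matrix_eq_sum_matrix_unit:
  "A = (\<Sum>a\<in>UNIV. \<Sum>b\<in>UNIV. matrix_scale (A $ a $ b) (matrix_unit a b))"
  for A :: "'a::field^'n^'m"
proof -
  have "(\<Sum>a\<in>UNIV. \<Sum>b\<in>UNIV. A $ a $ b * (if i = a \<and> j = b then 1 else 0)) = A $ i $ j" for i j
  proof -
    have "(\<Sum>a\<in>UNIV. \<Sum>b\<in>UNIV. A $ a $ b * (if i = a \<and> j = b then 1 else 0))
        = (\<Sum>a\<in>UNIV. \<Sum>b\<in>UNIV. if b = j then if a = i then A $ a $ b else 0 else 0)"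
      by (intro sum.cong refl) simp
    then show ?thesis
      by simp
  qed
  then show ?thesis
    by (simp add: vec_eq_iff matrix_scale_def matrix_unit_nth)
qed

text \<open>
  The sum over an infinite set is 0 by convention, so the identities depend on every basis of a space
  of matrices being finite. This holds since the matrix units are a finite spanning set.
\<close>

lemma finite_independent_matrices:
  fixes B :: "('a::field^'n^'m) set"
  assumes "matrix_vs.independent B"
  shows "finite B"
proof -
  let ?E = "range (\<lambda>(a, b). matrix_unit a b) :: ('a^'n^'m) set"
  have "A \<in> matrix_vs.span ?E" for A :: "'a^'n^'m"
  proof -
    have "matrix_unit a b \<in> ?E" for a b
      by force
    then have "(\<Sum>a\<in>UNIV. \<Sum>b\<in>UNIV. matrix_scale (A $ a $ b) (matrix_unit a b)) \<in> matrix_vs.span ?E"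
      by (intro matrix_vs.span_sum matrix_vs.span_scale matrix_vs.span_base)
    then show ?thesis
      by (simp only: matrix_eq_sum_matrix_unit[symmetric])
  qed
  then show ?thesis
    using matrix_vs.independent_span_bound[of ?E B] assms by auto
qed

lemma trace_linear_combination_mult:
  "trace ((\<Sum>\<alpha>\<in>B. matrix_scale (c \<alpha>) (f \<alpha>)) ** D) = (\<Sum>\<alpha>\<in>B. c \<alpha> * trace (f \<alpha> ** D))"
  for D :: "'a::field^'n^'n"
proof -
  have "trace (matrix_scale x A ** D) = x * trace (A ** D)" for x and A :: "'a^'n^'n"
    by (simp add: trace_def matrix_matrix_mult_def matrix_scale_def sum_distrib_left mult.assoc)
  moreover have "trace ((0::'a^'n^'n) ** D) = 0"
    by (simp add: trace_def matrix_matrix_mult_def)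
  moreover have "trace ((A + A') ** D) = trace (A ** D) + trace (A' ** D)" for A A' :: "'a^'n^'n"
    by (simp add: trace_def matrix_matrix_mult_def distrib_right sum.distrib)
  ultimately show ?thesis
    by (induction B rule: infinite_finite_induct) simp_all
qed

lemma trace_scaled_diff_mult:
  "trace (matrix_scale c (A - C) ** D) = c * (trace (A ** D) - trace (C ** D))"
  for D :: "'a::field^'n^'n"
  by (simp add: trace_def matrix_matrix_mult_def matrix_scale_def algebra_simps
      sum_distrib_left sum_subtractf)

lemma so_iff: "A \<in> so \<longleftrightarrow> (\<forall>i j. A $ j $ i = - A $ i $ j)"
  by (auto simp: so_def vec_eq_iff transpose_def)

lemma skew_part_in_so: "matrix_scale (1 / 2) (M - transpose M) \<in> so"
  for M :: "'a::field_char_0^'n^'n"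
  by (auto simp: so_iff matrix_scale_def transpose_def algebra_simps)

text \<open>The symmetric part of \<open>M\<close> is orthogonal to \<open>D\<close>, so \<open>M\<close> may be replaced by its skew part.\<close>

lemma trace_skew_part_mult:
  fixes M D :: "'a::field_char_0^'n^'n"
  assumes "D \<in> so"
  shows "trace (matrix_scale (1 / 2) (M - transpose M) ** D) = trace (M ** D)"
proof -
  have "trace (transpose M ** D) = trace (transpose (transpose M ** D))"
    by (simp add: trace_def transpose_def)
  also have "\<dots> = trace (M ** transpose D)"
    by (simp only: matrix_transpose_mul transpose_transpose trace_mul_sym[of M])
  also have "\<dots> = - trace (M ** D)"
  proof -
    have "transpose D = - D"
      using assms by (simp add: so_def)
    then show ?thesis
      by (simp add: trace_def matrix_matrix_mult_def sum_negf)
  qed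
  finally have "trace (transpose M ** D) = - trace (M ** D)" .
  then show ?thesis
    by (simp add: trace_scaled_diff_mult)
qed

text \<open>
  The coefficients of \<open>X\<close> in the basis are found by pairing with the dual basis: duality kills all
  terms but one.
\<close>

lemma so_expansion:
  fixes X :: "'a::field^'n^'n"
  assumes "is_basis_of B so" and "is_dual_basis_so B dual" and "X \<in> so"
  shows "(\<Sum>\<alpha>\<in>B. matrix_scale (trace (X ** dual \<alpha>)) \<alpha>) = X"
proof -
  have fin: "finite B"
    using assms(1) finite_independent_matrices by (auto simp: is_basis_of_def)
  have "X \<in> matrix_vs.span B"
    using assms by (simp add: is_basis_of_def)
  then obtain c where X: "X = (\<Sum>\<alpha>\<in>B. matrix_scale (c \<alpha>) \<alpha>)"
    using matrix_vs.span_finite[OF fin] by auto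
  have "trace (X ** dual \<beta>) = c \<beta>" if "\<beta> \<in> B" for \<beta>
  proof -
    have "trace (X ** dual \<beta>) = (\<Sum>\<alpha>\<in>B. c \<alpha> * trace (\<alpha> ** dual \<beta>))"
      unfolding X by (rule trace_linear_combination_mult)
    also have "\<dots> = (\<Sum>\<alpha>\<in>B. if \<alpha> = \<beta> then c \<alpha> else 0)"
      using assms(2) that by (intro sum.cong) (auto simp: is_dual_basis_so_def)
    also have "\<dots> = c \<beta>"
      using fin that by simp
    finally show ?thesis .
  qed
  then show ?thesis
    by (subst (2) X) (auto intro: sum.cong)
qed

lemma sum_trace_dual_eq_skew_part:
  fixes M :: "'a::field_char_0^'n^'n"
  assumes "is_basis_of B so" and "is_dual_basis_so B dual"
  shows "(\<Sum>\<alpha>\<in>B. matrix_scale (trace (M ** dual \<alpha>)) \<alpha>) = matrix_scale (1 / 2) (M - transpose M)"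
proof -
  have "dual \<alpha> \<in> so" if "\<alpha> \<in> B" for \<alpha>
    using assms(2) that by (auto simp: is_dual_basis_so_def)
  then show ?thesis
    using so_expansion[OF assms skew_part_in_so[of M]] by (simp add: trace_skew_part_mult)
qed

lemma sum_entry_dual_entry:
  fixes dual :: "'a::field_char_0^'n^'n \<Rightarrow> 'a^'n^'n"
  assumes "is_basis_of B so" and "is_dual_basis_so B dual"
  shows "(\<Sum>\<alpha>\<in>B. \<alpha> $ k $ l * dual \<alpha> $ i $ j)
    = 1 / 2 * ((if k = j \<and> l = i then 1 else 0) - (if k = i \<and> l = j then 1 else 0))"
proof -
  \<comment> \<open>Pairing with the unit in position \<open>(j, i)\<close> reads off the entry \<open>(i, j)\<close>.\<close>
  have "(\<Sum>\<alpha>\<in>B. matrix_scale (dual \<alpha> $ i $ j) \<alpha>) $ k $ l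
      = matrix_scale (1 / 2) (matrix_unit j i - transpose (matrix_unit j i)) $ k $ l"
    using sum_trace_dual_eq_skew_part[OF assms, of "matrix_unit j i"]
    by (simp add: trace_matrix_unit_mult)
  then show ?thesis
    by (auto simp: matrix_scale_def matrix_unit_nth transpose_def mult.commute)
qed

lemma sum_basis_mult_dual:
  fixes Q :: "'a::field_char_0^'n^'n"
  assumes "is_basis_of B so" and "is_dual_basis_so B dual"
  shows "(\<Sum>\<alpha>\<in>B. \<alpha> ** Q ** dual \<alpha>) = matrix_scale (1 / 2) (mat (trace Q) - transpose Q)"
proof -
  have "(\<Sum>\<alpha>\<in>B. \<alpha> ** Q ** dual \<alpha>) $ k $ j = 1 / 2 * ((if k = j then trace Q else 0) - Q $ j $ k)"
    for k j
  proof -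
    have "(\<Sum>\<alpha>\<in>B. \<alpha> ** Q ** dual \<alpha>) $ k $ j
        = (\<Sum>\<alpha>\<in>B. \<Sum>i\<in>UNIV. \<Sum>l\<in>UNIV. Q $ l $ i * (\<alpha> $ k $ l * dual \<alpha> $ i $ j))"
      by (simp add: matrix_matrix_mult_def sum_distrib_left mult_ac)
    also have "\<dots> = (\<Sum>i\<in>UNIV. \<Sum>\<alpha>\<in>B. \<Sum>l\<in>UNIV. Q $ l $ i * (\<alpha> $ k $ l * dual \<alpha> $ i $ j))"
      by (rule sum.swap)
    also have "\<dots> = (\<Sum>i\<in>UNIV. \<Sum>l\<in>UNIV. \<Sum>\<alpha>\<in>B. Q $ l $ i * (\<alpha> $ k $ l * dual \<alpha> $ i $ j))"
      by (intro sum.cong refl sum.swap)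
    also have "\<dots> = (\<Sum>i\<in>UNIV. \<Sum>l\<in>UNIV. Q $ l $ i
        * (1 / 2 * ((if k = j \<and> l = i then 1 else 0) - (if k = i \<and> l = j then 1 else 0))))"
      by (simp only: sum_distrib_left[symmetric] sum_entry_dual_entry[OF assms])
    also have "\<dots> = (\<Sum>i\<in>UNIV. \<Sum>l\<in>UNIV. 1 / 2 *
        ((if l = i then if k = j then Q $ l $ i else 0 else 0)
          - (if l = j then if i = k then Q $ l $ i else 0 else 0)))"
      by (intro sum.cong) auto
    also have "\<dots> = 1 / 2 * ((if k = j then trace Q else 0) - Q $ j $ k)"
      by (simp add: sum_distrib_left[symmetric] sum_subtractf trace_def
          sum_divide_distrib[symmetric])
    finally show ?thesis .
  qed
  then show ?thesis
    by (simp add: vec_eq_iff matrix_scale_def mat_def transpose_def)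
qed

theorem lemma3:
  fixes P Q :: "'a::field_char_0^'n^'n"
    and B :: "('a^'n^'n) set"
    and dual :: "'a^'n^'n \<Rightarrow> 'a^'n^'n"
  assumes "CARD('n) \<ge> 2"
    and "is_basis_of B so"
    and "is_dual_basis_so B dual"
  shows "(\<Sum>\<alpha>\<in>B. trace (P ** \<alpha> ** Q ** dual \<alpha>))
           = 1 / 2 * (trace P * trace Q - trace (P ** transpose Q))
       \<and> (\<Sum>\<alpha>\<in>B. trace (P ** \<alpha>) * trace (Q ** dual \<alpha>))
           = 1 / 2 * (trace (P ** Q) - trace (P ** transpose Q))"
proof
  have scale: "trace (matrix_scale (1 / 2) (A - transpose Q) ** P)
      = 1 / 2 * (trace (P ** A) - trace (P ** transpose Q))" for A
    by (simp only: trace_scaled_diff_mult trace_mul_sym[of P])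

  \<comment> \<open>The factor 1 lets the sum be read as a linear combination.\<close>
  have "(\<Sum>\<alpha>\<in>B. trace (P ** \<alpha> ** Q ** dual \<alpha>)) = (\<Sum>\<alpha>\<in>B. 1 * trace ((\<alpha> ** Q ** dual \<alpha>) ** P))"
    by (simp add: trace_mul_sym[of _ P] matrix_mul_assoc)
  also have "\<dots> = trace ((\<Sum>\<alpha>\<in>B. \<alpha> ** Q ** dual \<alpha>) ** P)"
    by (simp only: trace_linear_combination_mult[symmetric] matrix_vs.scale_one)
  also have "\<dots> = 1 / 2 * (trace (P ** mat (trace Q)) - trace (P ** transpose Q))"
    by (simp only: sum_basis_mult_dual[OF assms(2,3)] scale)
  also have "trace (P ** mat (trace Q)) = trace P * trace Q"
    by (simp add: trace_def matrix_matrix_mult_def mat_def sum_distrib_right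
        if_distrib[of "times _"] cong: if_cong)
  finally show "(\<Sum>\<alpha>\<in>B. trace (P ** \<alpha> ** Q ** dual \<alpha>))
      = 1 / 2 * (trace P * trace Q - trace (P ** transpose Q))" .

  have "(\<Sum>\<alpha>\<in>B. trace (P ** \<alpha>) * trace (Q ** dual \<alpha>))
      = (\<Sum>\<alpha>\<in>B. trace (Q ** dual \<alpha>) * trace (\<alpha> ** P))"
    by (simp add: trace_mul_sym[of _ P] mult.commute)
  also have "\<dots> = trace ((\<Sum>\<alpha>\<in>B. matrix_scale (trace (Q ** dual \<alpha>)) \<alpha>) ** P)"
    by (rule trace_linear_combination_mult[symmetric])
  also have "\<dots> = 1 / 2 * (trace (P ** Q) - trace (P ** transpose Q))"
    by (simp only: sum_trace_dual_eq_skew_part[OF assms(2,3)] scale)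
  finally show "(\<Sum>\<alpha>\<in>B. trace (P ** \<alpha>) * trace (Q ** dual \<alpha>))
      = 1 / 2 * (trace (P ** Q) - trace (P ** transpose Q))" .
qed

end
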